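(* Let $p\geq 2$ and let $G$ be a finite simple $\{pK_2, C_4\}$-free graph. Then $\chi(G)\leq f_p(\omega(G))$, where $f_p:\mathbb{N}\to\mathbb{N}$ ($p\geq2$) is defined by: $f_t(1)=1$ for $t\geq 2$; $f_2(s)=s+1$ for $s\geq 2$; $f_p(2)=2p-2$ for $p\geq 3$; and $f_p(m)=\left(\sum_{j=2}^{m} f_{p-1}(j)\right)+1$ for $m,p\geq 3$.
   Context: $\chi(G)$ is the chromatic number and $\omega(G)$ the clique number of $G$. $pK_2$ is the disjoint union of $p$ edges; $C_4$ is the cycle on four vertices. A graph is $\mathcal{F}$-free if it has no induced subgraph isomorphic to a member of $\mathcal{F}$. *)

theory Defs
  imports "HOL-Library.Ramsey"
begin

text \<open>A graph is a pair of a vertex set and a set of edges, an edge being a two-element set.\<close>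

type_synonym 'a sgraph = "'a set \<times> 'a set set"

abbreviation verts :: "'a sgraph \<Rightarrow> 'a set" where
  "verts G \<equiv> fst G"

abbreviation edges :: "'a sgraph \<Rightarrow> 'a set set" where
  "edges G \<equiv> snd G"

definition fin_simple_graph :: "'a sgraph \<Rightarrow> bool" where
  "fin_simple_graph G \<longleftrightarrow> finite (verts G) \<and> edges G \<subseteq> [verts G]\<^bsup>2\<^esup>"

definition is_clique :: "'a sgraph \<Rightarrow> 'a set \<Rightarrow> bool" where
  "is_clique G K \<longleftrightarrow> K \<subseteq> verts G \<and> [K]\<^bsup>2\<^esup> \<subseteq> edges G"

definition clique_number :: "'a sgraph \<Rightarrow> nat" where
  "clique_number G = Max {card K |K. is_clique G K}"

definition proper_coloring :: "'a sgraph \<Rightarrow> nat \<Rightarrow> ('a \<Rightarrow> nat) \<Rightarrow> bool" where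
  "proper_coloring G k c \<longleftrightarrow>
     c \<in> verts G \<rightarrow> {..<k} \<and> (\<forall>u v. {u, v} \<in> edges G \<longrightarrow> c u \<noteq> c v)"

definition chromatic_number :: "'a sgraph \<Rightarrow> nat" where
  "chromatic_number G = (LEAST k. \<exists>c. proper_coloring G k c)"

definition induced_subgraph :: "'a sgraph \<Rightarrow> 'a set \<Rightarrow> 'a sgraph" where
  "induced_subgraph G S = (S, {e \<in> edges G. e \<subseteq> S})"

definition isomorphic :: "'a sgraph \<Rightarrow> 'b sgraph \<Rightarrow> bool" where
  "isomorphic G H \<longleftrightarrow>
     (\<exists>\<phi>. bij_betw \<phi> (verts G) (verts H) \<and>
        (\<forall>u\<in>verts G. \<forall>v\<in>verts G. {u, v} \<in> edges G \<longleftrightarrow> {\<phi> u, \<phi> v} \<in> edges H))"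

definition free_of :: "'b sgraph set \<Rightarrow> 'a sgraph \<Rightarrow> bool" where
  "free_of \<F> G \<longleftrightarrow>
     \<not> (\<exists>H\<in>\<F>. \<exists>S\<subseteq>verts G. isomorphic (induced_subgraph G S) H)"

definition matching_graph :: "nat \<Rightarrow> nat sgraph" where
  "matching_graph p = ({..<2 * p}, {{2 * i, 2 * i + 1} |i. i < p})"

definition cycle_graph :: "nat \<Rightarrow> nat sgraph" where
  "cycle_graph n = ({..<n}, {{i, (i + 1) mod n} |i. i < n})"

text \<open>Only the values with \<open>p \<ge> 2\<close> and \<open>m \<ge> 1\<close> are meaningful; the remaining ones are set to 0.
  The value at \<open>m = 0\<close> is met only by the empty graph, whose chromatic number is 0.\<close>

fun chi_bound :: "nat \<Rightarrow> nat \<Rightarrow> nat" where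
  "chi_bound p m =
     (if p < 2 \<or> m = 0 then 0
      else if m = 1 then 1
      else if p = 2 then m + 1
      else if m = 2 then 2 * p - 2
      else (\<Sum>j = 2..m. chi_bound (p - 1) j) + 1)"

declare chi_bound.simps [simp del]

lemma chi_bound_1: "t \<ge> 2 \<Longrightarrow> chi_bound t 1 = 1"
  by (subst chi_bound.simps) simp

lemma chi_bound_p2: "s \<ge> 2 \<Longrightarrow> chi_bound 2 s = s + 1"
  by (subst chi_bound.simps) simp

lemma chi_bound_m2: "p \<ge> 3 \<Longrightarrow> chi_bound p 2 = 2 * p - 2"
  by (subst chi_bound.simps) simp

lemma chi_bound_rec:
  "m \<ge> 3 \<Longrightarrow> p \<ge> 3 \<Longrightarrow> chi_bound p m = (\<Sum>j = 2..m. chi_bound (p - 1) j) + 1"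
  by (subst chi_bound.simps) simp

end

theory Submission
  imports Defs
begin

text \<open>Let \<open>v\<^sub>1, \<dots>, v\<^sub>m\<close> be a maximum clique with \<open>m \<ge> 2\<close>. For \<open>i < j\<close> let \<open>A\<^sub>i\<^sub>j\<close> be the set of
  vertices whose two smallest non-neighbours in the clique are \<open>v\<^sub>i\<close> and \<open>v\<^sub>j\<close>. It is free of
  \<open>(p - 1)K\<^sub>2\<close>, because the edge \<open>v\<^sub>iv\<^sub>j\<close> is anticomplete to it, and its cliques have at most
  \<open>m - j + 2\<close> vertices, because \<open>j - 2\<close> vertices of the clique are complete to it. If \<open>i \<noteq> i'\<close>, an edge
  \<open>xy\<close> between \<open>A\<^sub>i\<^sub>j\<close> and \<open>A\<^sub>i\<^sub>'\<^sub>j\<close> would give the induced four-cycle \<open>x, v\<^sub>i\<^sub>', v\<^sub>i, y\<close>; hence all the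
  \<open>A\<^sub>i\<^sub>j\<close> with the same \<open>j\<close> can share the colours of level \<open>j\<close>. For the same reason the vertices
  outside the clique with exactly one non-neighbour in it form an independent set, which takes
  one more colour. Finally \<open>v\<^sub>j\<close> with \<open>j \<ge> 2\<close> reuses a colour of level \<open>j\<close>, and
  \<open>v\<^sub>1\<close> a second colour of level 2, which consists of \<open>A\<^sub>1\<^sub>2\<close> only.\<close>

section \<open>Lower bounds and monotonicity of \<open>chi_bound\<close>\<close>

lemma chi_bound_0 [simp]: "chi_bound p 0 = 0"
  by (subst chi_bound.simps) simp

text \<open>Level 2 must offer two colours, since \<open>v 1\<close> and \<open>v 2\<close> each
  take one there.\<close>

lemma chi_bound_ge_2:
  assumes "p \<ge> 2" "m \<ge> 2"
  shows "chi_bound p m \<ge> 2"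
  using assms
proof (induction p arbitrary: m rule: less_induct)
  case (less p)
  consider "p = 2" | "p \<ge> 3" "m = 2" | "p \<ge> 3" "m \<ge> 3"
    using less.prems by linarith
  then show ?case
  proof cases
    case 1
    then show ?thesis using less.prems by (simp add: chi_bound_p2)
  next
    case 2
    then show ?thesis by (simp add: chi_bound_m2)
  next
    case 3
    have "2 \<le> chi_bound (p - 1) 2"
      using 3 by (intro less.IH) auto
    also have "\<dots> \<le> (\<Sum>j = 2..m. chi_bound (p - 1) j)"
      using 3 by (intro member_le_sum) auto
    finally show ?thesis using 3 by (simp add: chi_bound_rec)
  qed
qed

text \<open>For \<open>m = 2\<close> the value is prescribed instead of given by the recursion. The
  recursion would give 4 for \<open>p = 3\<close>, which is the prescribed value, and
  \<open>2 * p - 3\<close> for \<open>p \<ge> 4\<close>, one less than the prescribed value.\<close>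

lemma sum_chi_bound_le:
  assumes "p \<ge> 3" "m \<ge> 2"
  shows "(\<Sum>j = 2..m. chi_bound (p - 1) j) + 1 \<le> chi_bound p m"
proof (cases "m = 2")
  case True
  have "chi_bound (p - 1) 2 + 1 \<le> 2 * p - 2"
  proof (cases "p = 3")
    case True
    then show ?thesis by (simp add: chi_bound_p2)
  next
    case False
    then show ?thesis using assms by (simp add: chi_bound_m2)
  qed
  then show ?thesis using True assms by (simp add: chi_bound_m2)
next
  case False
  then show ?thesis using assms by (simp add: chi_bound_rec)
qed

text \<open>The delicate step is from 2 to 3, where the prescribed value \<open>2 * p - 2\<close>
  gives way to the sum.\<close>

lemma chi_bound_Suc_mono:
  assumes "p \<ge> 2"
  shows "chi_bound p m \<le> chi_bound p (Suc m)"
proof -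
  consider "m = 0" | "m = 1" | "p = 2" "m \<ge> 2" | "p \<ge> 3" "m \<ge> 3" | "p = 3" "m = 2" | "p \<ge> 4" "m = 2"
    using assms by linarith
  then show ?thesis
  proof cases
    case 2
    then show ?thesis
      using chi_bound_ge_2[of p 2] chi_bound_1[of p] assms by (simp add: numeral_2_eq_2)
  next
    case 4
    then show ?thesis by (simp add: chi_bound_rec)
  next
    case 5
    have "(\<Sum>j = 2..3. chi_bound 2 j) = 7"
      by (simp add: chi_bound_p2 numeral_3_eq_3 numeral_2_eq_2 atLeastAtMostSuc_conv)
        (simp add: chi_bound_p2 flip: numeral_3_eq_3 numeral_2_eq_2)
    then show ?thesis using 5 by (simp add: chi_bound_rec chi_bound_m2)
  next
    case 6
    have "{2..3} = {2, 3::nat}" by auto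
    then have "chi_bound p 3 = (\<Sum>j\<in>{2, 3}. chi_bound (p - 1) j) + 1"
      using 6 by (simp add: chi_bound_rec)
    \<comment> \<open>The summand for 2 is \<open>2 * p - 4\<close>, so a further summand of at
      least 2 exceeds the prescribed value.\<close>
    moreover have "2 \<le> chi_bound (p - 1) 3" using 6 by (intro chi_bound_ge_2) auto
    ultimately show ?thesis using 6 by (simp add: chi_bound_m2)
  qed (use assms in \<open>simp_all add: chi_bound_p2\<close>)
qed

lemma chi_bound_mono:
  assumes "p \<ge> 2" "m \<le> n"
  shows "chi_bound p m \<le> chi_bound p n"
  using assms(2) by (rule lift_Suc_mono_le[of "chi_bound p", OF chi_bound_Suc_mono[OF assms(1)]])

section \<open>C4-free relations and induced matchings\<close>

text \<open>Adjacency is a bare relation, so that the induction can pass to vertex subsets without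
  forming induced subgraphs. In \<open>c4_free\<close> only opposite vertices are required to
  differ; consecutive ones do so by irreflexivity.\<close>

locale c4_free_relation =
  fixes adj :: "'a \<Rightarrow> 'a \<Rightarrow> bool"
  assumes adj_sym: "adj u v \<Longrightarrow> adj v u"
    and adj_irrefl: "\<not> adj u u"
    and c4_free: "\<lbrakk>adj a b; adj b c; adj c d; adj d a; a \<noteq> c; b \<noteq> d\<rbrakk> \<Longrightarrow> adj a c \<or> adj b d"
begin

definition clique :: "'a set \<Rightarrow> bool" where
  "clique K \<longleftrightarrow> (\<forall>u\<in>K. \<forall>v\<in>K. u \<noteq> v \<longrightarrow> adj u v)"

lemma clique_subset: "\<lbrakk>clique K; L \<subseteq> K\<rbrakk> \<Longrightarrow> clique L"
  unfolding clique_def by blast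

lemma clique_insert: "\<lbrakk>clique K; \<And>w. w \<in> K \<Longrightarrow> adj x w\<rbrakk> \<Longrightarrow> clique (insert x K)"
  unfolding clique_def using adj_sym by blast

definition colorable :: "'a set \<Rightarrow> nat \<Rightarrow> bool" where
  "colorable S k \<longleftrightarrow> (\<exists>c. c ` S \<subseteq> {..<k} \<and> (\<forall>u\<in>S. \<forall>v\<in>S. adj u v \<longrightarrow> c u \<noteq> c v))"

text \<open>Edges are peeled off one at a time, so an edge anticomplete to a set extends an induced
  matching of that set directly. The ends \<open>u\<close> and \<open>v\<close> drop out of the
  remaining set because they are adjacent to each other.\<close>

fun has_induced_matching :: "nat \<Rightarrow> 'a set \<Rightarrow> bool" where
  "has_induced_matching 0 S \<longleftrightarrow> True"
| "has_induced_matching (Suc p) S \<longleftrightarrow>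
    (\<exists>u\<in>S. \<exists>v\<in>S. adj u v \<and> has_induced_matching p {x \<in> S. \<not> adj x u \<and> \<not> adj x v})"

lemma has_induced_matching_mono:
  "\<lbrakk>has_induced_matching p S; S \<subseteq> T\<rbrakk> \<Longrightarrow> has_induced_matching p T"
proof (induction p arbitrary: S T)
  case (Suc p)
  then obtain u v where uv: "u \<in> S" "v \<in> S" "adj u v"
    "has_induced_matching p {x \<in> S. \<not> adj x u \<and> \<not> adj x v}" by auto
  have "has_induced_matching p {x \<in> T. \<not> adj x u \<and> \<not> adj x v}"
    by (rule Suc.IH[OF uv(4)]) (use Suc.prems in auto)
  then show ?case using uv Suc.prems by auto
qed simp

lemma has_induced_matching_embedding:
  "has_induced_matching p S \<Longrightarrow>
    \<exists>f. inj_on f {..<2 * p} \<and> f ` {..<2 * p} \<subseteq> S \<and>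
      (\<forall>i<2 * p. \<forall>j<2 * p. adj (f i) (f j) \<longleftrightarrow> i \<noteq> j \<and> i div 2 = j div 2)"
proof (induction p arbitrary: S)
  case (Suc p)
  then obtain u v where uv: "u \<in> S" "v \<in> S" "adj u v"
    "has_induced_matching p {x \<in> S. \<not> adj x u \<and> \<not> adj x v}" by auto
  obtain f where f: "inj_on f {..<2 * p}"
    "f ` {..<2 * p} \<subseteq> {x \<in> S. \<not> adj x u \<and> \<not> adj x v}"
    "\<forall>i<2 * p. \<forall>j<2 * p. adj (f i) (f j) \<longleftrightarrow> i \<noteq> j \<and> i div 2 = j div 2"
    using Suc.IH[OF uv(4)] by blast
  \<comment> \<open>The new edge takes the last two indices, which leaves the numbering of the old
    edges intact.\<close>
  define g where "g = f(2 * p := u, 2 * p + 1 := v)"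
  have g: "g (2 * p) = u" "g (Suc (2 * p)) = v" "\<And>i. i < 2 * p \<Longrightarrow> g i = f i"
    by (auto simp: g_def)
  have D: "{..<2 * Suc p} = insert (2 * p) (insert (Suc (2 * p)) {..<2 * p})" by auto
  \<comment> \<open>\<open>f i\<close> differs from \<open>u\<close> because \<open>u\<close> is
    adjacent to \<open>v\<close> and \<open>f i\<close> is not; likewise for
    \<open>v\<close>.\<close>
  have fi: "f i \<in> S" "\<not> adj (f i) u" "\<not> adj (f i) v" "\<not> adj u (f i)" "\<not> adj v (f i)"
    "f i \<noteq> u" "f i \<noteq> v" if "i < 2 * p" for i
    using f(2) that adj_sym uv(3) by blast+
  have "u \<noteq> v" using uv adj_irrefl by auto
  have img: "g ` {..<2 * p} = f ` {..<2 * p}" using g by (intro image_cong) auto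
  have "inj_on g {..<2 * p}" using f(1) g(3) by (auto simp: inj_on_def)
  moreover have "u \<notin> g ` {..<2 * p}" "v \<notin> g ` {..<2 * p}"
    unfolding img using fi(6,7) by (metis imageE lessThan_iff)+
  ultimately have "inj_on g {..<2 * Suc p}"
    unfolding D using \<open>u \<noteq> v\<close> g(1,2) by simp
  moreover have "g ` {..<2 * Suc p} \<subseteq> S"
    unfolding D using uv fi(1) img g by auto
  moreover have "adj (g i) (g j) \<longleftrightarrow> i \<noteq> j \<and> i div 2 = j div 2"
    if ij: "i < 2 * Suc p" "j < 2 * Suc p" for i j
  proof -
    have *: "k < 2 * p \<or> k = 2 * p \<or> k = Suc (2 * p)" if "k < 2 * Suc p" for k
      using that by auto
    have small: "k div 2 \<noteq> p" "p \<noteq> k div 2" if "k < 2 * p" for k using that by auto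
    show ?thesis
      using *[OF ij(1)] *[OF ij(2)] f(3) fi uv(3) adj_sym[OF uv(3)] adj_irrefl
      by (elim disjE) (simp_all add: g small)
  qed
  ultimately show ?case by blast
qed simp

section \<open>Colouring around a maximum clique\<close>

lemma colorable_mono: "\<lbrakk>colorable S k; k \<le> l\<rbrakk> \<Longrightarrow> colorable S l"
  unfolding colorable_def by (meson lessThan_subset_iff order_trans)

lemma colorable_1_if_no_edge:
  assumes "\<And>x y. \<lbrakk>x \<in> S; y \<in> S\<rbrakk> \<Longrightarrow> \<not> adj x y"
  shows "colorable S 1"
  unfolding colorable_def using assms by (intro exI[of _ "\<lambda>_. 0"]) auto

lemma colorable_if_finite_colors:
  assumes "finite C" "c ` S \<subseteq> C" "\<And>u v. \<lbrakk>u \<in> S; v \<in> S; adj u v\<rbrakk> \<Longrightarrow> c u \<noteq> c v"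
  shows "colorable S (card C)"
proof -
  obtain h where h: "bij_betw h C {..<card C}"
    using ex_bij_betw_finite_nat[OF assms(1)] by (auto simp: atLeast0LessThan)
  have "(h \<circ> c) ` S \<subseteq> {..<card C}"
    using assms(2) h by (auto simp: bij_betw_def)
  moreover have "(h \<circ> c) u \<noteq> (h \<circ> c) v" if "u \<in> S" "v \<in> S" "adj u v" for u v
    using assms(2) assms(3)[OF that] that h by (auto simp: bij_betw_def dest!: inj_onD)
  ultimately show ?thesis unfolding colorable_def by blast
qed

text \<open>The colouring is separated from the induction: \<open>N j\<close> is the number of
  colours of level \<open>j\<close>, whatever its source. It is used with 2, 1, 1, ... for
  \<open>p = 2\<close> and with values of \<open>chi_bound (p - 1)\<close> for larger
  \<open>p\<close>.\<close>

lemma colorable_by_max_clique: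
  fixes v :: "nat \<Rightarrow> 'a" and N :: "nat \<Rightarrow> nat"
  assumes m: "m \<ge> 2"
    and v: "inj_on v {1..m}" "v ` {1..m} \<subseteq> S" "clique (v ` {1..m})"
    and max: "\<And>Q. \<lbrakk>Q \<subseteq> S; finite Q; clique Q\<rbrakk> \<Longrightarrow> card Q \<le> m"
    and N: "N 2 \<ge> 2" "\<And>j. j \<in> {2..m} \<Longrightarrow> N j \<ge> 1"
    and A: "\<And>i j. \<lbrakk>1 \<le> i; i < j; j \<le> m\<rbrakk> \<Longrightarrow>
      colorable {x \<in> S. \<not> adj x (v i) \<and> \<not> adj x (v j) \<and> (\<forall>k\<in>{1..<j} - {i}. adj x (v k))} (N j)"
  shows "colorable S ((\<Sum>j = 2..m. N j) + 1)"
proof -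
  let ?K = "v ` {1..m}"
  let ?A = "\<lambda>i j. {x \<in> S. \<not> adj x (v i) \<and> \<not> adj x (v j) \<and> (\<forall>k\<in>{1..<j} - {i}. adj x (v k))}"
  have vadj: "adj (v i) (v j)" if "i \<in> {1..m}" "j \<in> {1..m}" "i \<noteq> j" for i j
  proof -
    have "v i \<noteq> v j" using that v(1) by (auto dest: inj_onD)
    then show ?thesis using that v(3) unfolding clique_def by blast
  qed
  define D where "D x = {i \<in> {1..m}. \<not> adj x (v i)}" for x
  \<comment> \<open>If \<open>x\<close> has a single non-neighbour in the clique, \<open>b x\<close>
    is the minimum of an empty set and has no meaning; every use of it is guarded by
    \<open>D x \<noteq> {a x}\<close>.\<close>
  define a where "a x = Min (D x)" for x
  define b where "b x = Min (D x - {a x})" for x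
  have fD [simp]: "finite (D x)" for x by (simp add: D_def)
  \<comment> \<open>A vertex complete to the maximum clique would enlarge it.\<close>
  have D_ne: "D x \<noteq> {}" if "x \<in> S" "x \<notin> ?K" for x
  proof
    assume "D x = {}"
    then have "clique (insert x ?K)"
      using v(3) adj_sym unfolding clique_def D_def by blast
    then have "card (insert x ?K) \<le> m" using that v(2) by (intro max) auto
    then show False using that v(1) by (simp add: card_image)
  qed
  have a: "a x \<in> D x" if "x \<in> S" "x \<notin> ?K" for x
    unfolding a_def using D_ne[OF that] by simp
  have Dab: "a x \<in> {1..m}" "b x \<in> {1..m}" "a x < b x" "x \<in> ?A (a x) (b x)"
    if x: "x \<in> S" "x \<notin> ?K" "D x \<noteq> {a x}" for x
  proof -
    have "D x - {a x} \<noteq> {}" using a[OF x(1,2)] x(3) by auto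
    then have bx: "b x \<in> D x - {a x}" unfolding b_def using Min_in[of "D x - {a x}"] by simp
    have "a x \<le> b x" unfolding a_def using bx by (intro Min_le) auto
    then show ab: "a x < b x" using bx by auto
    show "a x \<in> {1..m}" "b x \<in> {1..m}" using a[OF x(1,2)] bx by (auto simp: D_def)
    have "adj x (v k)" if "k \<in> {1..<b x} - {a x}" for k
    proof (rule ccontr)
      assume "\<not> adj x (v k)"
      then have "k \<in> D x - {a x}" using that \<open>b x \<in> {1..m}\<close> by (auto simp: D_def)
      then have "b x \<le> k" unfolding b_def by (intro Min_le) auto
      then show False using that by auto
    qed
    then show "x \<in> ?A (a x) (b x)" using a[OF x(1,2)] bx x(1) by (auto simp: D_def)
  qed
  \<comment> \<open>One colouring is fixed for each pair; its palette \<open>{..<N j}\<close> does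
    not depend on \<open>i\<close>, so all sets of level \<open>j\<close> share it.\<close>
  define proper where "proper i j c \<longleftrightarrow> c ` ?A i j \<subseteq> {..<N j} \<and>
      (\<forall>x\<in>?A i j. \<forall>y\<in>?A i j. adj x y \<longrightarrow> c x \<noteq> c y)" for i j c
  define c where "c i j = (SOME c. proper i j c)" for i j
  have "\<exists>c. proper i j c" if "1 \<le> i" "i < j" "j \<le> m" for i j
    using A[OF that] by (simp only: colorable_def proper_def)
  then have "proper i j (c i j)" if "1 \<le> i" "i < j" "j \<le> m" for i j
    unfolding c_def using that someI_ex[of "proper i j"] by blast
  then have c: "c i j ` ?A i j \<subseteq> {..<N j} \<and> (\<forall>x\<in>?A i j. \<forall>y\<in>?A i j. adj x y \<longrightarrow> c i j x \<noteq> c i j y)"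
    if "1 \<le> i" "i < j" "j \<le> m" for i j
    using that unfolding proper_def by blast
  \<comment> \<open>A colour is a pair of a level and a colour within it. Levels start at 2, so
    \<open>(0, 0)\<close> is new; it goes to the vertices with a single non-neighbour.\<close>
  define C where "C = insert (0, 0) (SIGMA j:{2..m}. {..<N j})"
  define col where "col x =
    (if x \<in> ?K then (if x = v 1 then (2, 1) else (the_inv_into {1..m} v x, 0))
     else if D x = {a x} then (0, 0) else (b x, c (a x) (b x) x))" for x
  have cardC: "card C = (\<Sum>j = 2..m. N j) + 1"
    unfolding C_def by (subst card_insert_disjoint) (auto simp: card_SigmaI)
  have col_K: "col (v k) = (if k = 1 then (2, 1) else (k, 0))" if "k \<in> {1..m}" for k
  proof -
    have "v k = v 1 \<longleftrightarrow> k = 1" using v(1) that m by (auto dest: inj_onD)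
    then show ?thesis using that the_inv_into_f_f[OF v(1) that] by (simp add: col_def)
  qed
  have col_1: "col x = (0, 0)" if "x \<notin> ?K" "D x = {a x}" for x
    using that by (simp add: col_def)
  have col_2: "col x = (b x, c (a x) (b x) x)" if "x \<notin> ?K" "D x \<noteq> {a x}" for x
    unfolding col_def using that by (simp only: if_False)
  have "col x \<in> C" if x: "x \<in> S" for x
  proof (cases "x \<in> ?K")
    case True
    then obtain k where k: "k \<in> {1..m}" "x = v k" by blast
    then show ?thesis using col_K[OF k(1)] m N(1) N(2)[of k] by (auto simp: C_def)
  next
    case False
    note xK = this
    show ?thesis
    proof (cases "D x = {a x}")
      case True
      then show ?thesis using col_1[OF xK] by (simp add: C_def)
    next
      case False
      note d = Dab[OF x xK False]
      have "c (a x) (b x) x \<in> {..<N (b x)}"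
        using c[THEN conjunct1, OF _ d(3)] d by (simp only: image_subset_iff) auto
      then show ?thesis using col_2[OF xK False] d(1-3) by (auto simp: C_def)
    qed
  qed
  then have col_C: "col ` S \<subseteq> C" by blast
  have c4: False
    if "adj x y" "x \<notin> ?K" "y \<notin> ?K" "i \<in> {1..m}" "i' \<in> {1..m}" "i \<noteq> i'" "adj x (v i')" "\<not> adj x (v i)"
      "adj y (v i)" "\<not> adj y (v i')" for x y i i'
  proof -
    have "x \<noteq> v i" "v i' \<noteq> y" using that by blast+
    then show ?thesis
      using c4_free[of x "v i'" "v i" y] vadj[of i' i] that adj_sym by blast
  qed
  \<comment> \<open>A neighbour \<open>y\<close> of \<open>v k\<close> is not adjacent to
    \<open>v (b y)\<close>, so \<open>k \<noteq> b y\<close> and the colour \<open>(k, 0)\<close> is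
    safe. On level 2, \<open>a y\<close> must be 1, so \<open>y\<close> is not adjacent to
    \<open>v 1\<close> and the colour \<open>(2, 1)\<close> of \<open>v 1\<close> is safe
    too.\<close>
  have clique_vs_rest: "col (v k) \<noteq> col y"
    if k: "k \<in> {1..m}" and y: "y \<in> S" "y \<notin> ?K" and kadj: "adj y (v k)" for k y
  proof (cases "D y = {a y}")
    case True
    then show ?thesis using col_K[OF k] col_1[OF y(2)] k by auto
  next
    case False
    note d = Dab[OF y False]
    have "a y = 1" if "b y = 2" using d(1,3) that by auto
    then have "k \<noteq> 1" if "b y = 2" using that d(4) kadj by auto
    moreover have "k \<noteq> b y" using d(4) kadj by auto
    ultimately show ?thesis using col_K[OF k] col_2[OF y(2) False] by (auto split: if_splits)
  qed
  have "col x \<noteq> col y" if x: "x \<in> S" and y: "y \<in> S" and xy: "adj x y" for x y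
  proof -
    consider (KK) "x \<in> ?K" "y \<in> ?K" | (K1) "x \<in> ?K" "y \<notin> ?K" | (K2) "x \<notin> ?K" "y \<in> ?K"
      | (R) "x \<notin> ?K" "y \<notin> ?K" by blast
    then show ?thesis
    proof cases
      case KK
      then obtain k l where kl: "k \<in> {1..m}" "x = v k" "l \<in> {1..m}" "y = v l" by blast
      then have "k \<noteq> l" using xy adj_irrefl by auto
      then show ?thesis using col_K[OF kl(1)] col_K[OF kl(3)] kl by auto
    next
      case K1
      then show ?thesis using clique_vs_rest y adj_sym[OF xy] by blast
    next
      case K2
      then obtain k where k: "k \<in> {1..m}" "y = v k" by blast
      then show ?thesis using clique_vs_rest[OF k(1) x K2(1)] xy by simp
    next
      case R
      note dx = Dab[OF x R(1)] and dy = Dab[OF y R(2)]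
      show ?thesis
      proof (cases "D x = {a x}"; cases "D y = {a y}")
        assume Dx: "D x = {a x}" and Dy: "D y = {a y}"
        have nx: "adj x (v k) \<longleftrightarrow> k \<noteq> a x" if "k \<in> {1..m}" for k
          using Dx that by (auto simp: D_def)
        have ny: "adj y (v k) \<longleftrightarrow> k \<noteq> a y" if "k \<in> {1..m}" for k
          using Dy that by (auto simp: D_def)
        have am: "a x \<in> {1..m}" "a y \<in> {1..m}"
          using a[OF x R(1)] a[OF y R(2)] by (auto simp: D_def)
        \<comment> \<open>Different non-neighbours would give a four-cycle. With a common one,
          exchanging it for \<open>x\<close> and \<open>y\<close> yields a clique of
          \<open>m + 1\<close> vertices.\<close>
        have "a x = a y"
          using c4[OF xy R am] nx[OF am(1)] nx[OF am(2)] ny[OF am(1)] ny[OF am(2)] by auto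
        let ?L = "v ` ({1..m} - {a x})"
        have "clique ?L" by (rule clique_subset[OF v(3)]) auto
        moreover have "adj x w" "adj y w" if "w \<in> ?L" for w
          using that nx ny \<open>a x = a y\<close> by auto
        ultimately have "clique (insert x (insert y ?L))"
          using xy by (intro clique_insert) auto
        moreover have "insert x (insert y ?L) \<subseteq> S" using v(2) x y by auto
        ultimately have "card (insert x (insert y ?L)) \<le> m" by (intro max) auto
        moreover have "card (insert x (insert y ?L)) = Suc (Suc (card ?L))"
          using R xy adj_irrefl by (subst card_insert_disjoint, auto)+
        moreover have "card ?L = m - 1"
          using am v(1) by (subst card_image) (auto intro: inj_on_subset)
        ultimately show ?thesis using m by simp
      next
        assume "D x = {a x}" "D y \<noteq> {a y}"
        then show ?thesis using col_1[OF R(1)] col_2[OF R(2)] dy(2) by auto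
      next
        assume "D x \<noteq> {a x}" "D y = {a y}"
        then show ?thesis using col_2[OF R(1)] col_1[OF R(2)] dx(2) by auto
      next
        assume nx: "D x \<noteq> {a x}" and ny: "D y \<noteq> {a y}"
        note dx = dx[OF nx] and dy = dy[OF ny]
        show ?thesis
        proof
          assume "col x = col y"
          then have eq: "b x = b y" "c (a x) (b x) x = c (a y) (b y) y"
            using col_2[OF R(1) nx] col_2[OF R(2) ny] by auto
          show False
          proof (cases "a x = a y")
            case True
            have "1 \<le> a x" "b x \<le> m" using dx(1,2) by auto
            moreover have "y \<in> ?A (a x) (b x)" using dy(4) True eq(1) by simp
            ultimately show ?thesis
              using c[THEN conjunct2, OF _ dx(3), THEN bspec, OF _ _ dx(4), THEN bspec] xy eq(2) True eq(1)
              by simp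
          next
            case False
            \<comment> \<open>Both first non-neighbours lie below the common second one, so each of
              \<open>x\<close> and \<open>y\<close> is adjacent to the first non-neighbour of the
              other.\<close>
            have "a y \<in> {1..<b x} - {a x}" "a x \<in> {1..<b y} - {a y}"
              using False dx(1,3) dy(1,3) eq(1) by auto
            then show ?thesis using c4[OF xy R dx(1) dy(1) False] dx(4) dy(4) by blast
          qed
        qed
      qed
    qed
  qed
  then have "colorable S (card C)"
    using col_C by (intro colorable_if_finite_colors[of C col]) (auto simp: C_def)
  then show ?thesis by (simp add: cardC)
qed

text \<open>Strong induction on \<open>p\<close>. Here \<open>n\<close> only bounds the clique sizes
  from above, because for the sets of level \<open>j\<close> just the bound \<open>m + 2 - j\<close>
  is known.\<close>

lemma colorable_chi_bound:
  assumes "p \<ge> 2" "finite S" "\<not> has_induced_matching p S"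
    and "\<And>Q. \<lbrakk>Q \<subseteq> S; clique Q\<rbrakk> \<Longrightarrow> card Q \<le> n"
  shows "colorable S (chi_bound p n)"
  using assms
proof (induction p arbitrary: S n rule: less_induct)
  case (less p)
  \<comment> \<open>The colouring is built for the exact clique number \<open>m\<close>;
    monotonicity of the bound then passes to \<open>n\<close>.\<close>
  define m where "m = Max (card ` {Q. Q \<subseteq> S \<and> clique Q})"
  have fin: "finite {Q. Q \<subseteq> S \<and> clique Q}" using less.prems(2) by auto
  have ne: "{} \<in> {Q. Q \<subseteq> S \<and> clique Q}" by (simp add: clique_def)
  have max: "card Q \<le> m" if "Q \<subseteq> S" "clique Q" for Q
    unfolding m_def using fin that by (intro Max_ge) auto
  obtain K where K: "K \<subseteq> S" "clique K" "card K = m"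
    using Max_in[of "card ` {Q. Q \<subseteq> S \<and> clique Q}"] fin ne unfolding m_def by fastforce
  have "m \<le> n" using less.prems(4)[OF K(1,2)] K(3) by simp
  have "colorable S (chi_bound p m)"
  proof (cases "m \<ge> 2")
    case False
    have noedge: "\<not> adj x y" if "x \<in> S" "y \<in> S" for x y
    proof
      assume "adj x y"
      then have "card {x, y} \<le> m"
        using that adj_sym by (intro max) (auto simp: clique_def)
      moreover have "x \<noteq> y" using \<open>adj x y\<close> adj_irrefl by auto
      ultimately show False using False by simp
    qed
    show ?thesis
    proof (cases "S = {}")
      case True
      then show ?thesis by (simp add: colorable_def)
    next
      case nonempty: False
      then obtain x where "x \<in> S" by blast
      then have "card {x} \<le> m" by (intro max) (auto simp: clique_def)
      then have "m = 1" using False by simp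
      moreover have "colorable S 1" using noedge by (rule colorable_1_if_no_edge)
      ultimately show ?thesis using chi_bound_1[OF less.prems(1)] by simp
    qed
  next
    case m: True
    have finK: "finite K" using K(1) less.prems(2) finite_subset by blast
    obtain v where bv: "bij_betw v {1..m} K"
      using ex_bij_betw_nat_finite_1[OF finK] K(3) by auto
    then have vK: "v ` {1..m} = K" and inj: "inj_on v {1..m}" by (auto simp: bij_betw_def)
    let ?A = "\<lambda>i j. {x \<in> S. \<not> adj x (v i) \<and> \<not> adj x (v j) \<and> (\<forall>k\<in>{1..<j} - {i}. adj x (v k))}"
    have vS: "v i \<in> S" if "i \<in> {1..m}" for i
      using that vK K(1) by blast
    have vadj: "adj (v i) (v j)" if "i \<in> {1..m}" "j \<in> {1..m}" "i \<noteq> j" for i j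
    proof -
      have "v i \<noteq> v j" using that inj by (auto dest: inj_onD)
      then show ?thesis using that vK K(2) unfolding clique_def by blast
    qed
    have A_free: "\<not> has_induced_matching (p - 1) (?A i j)" if "1 \<le> i" "i < j" "j \<le> m" for i j
    proof
      assume "has_induced_matching (p - 1) (?A i j)"
      then have "has_induced_matching (p - 1) {x \<in> S. \<not> adj x (v i) \<and> \<not> adj x (v j)}"
        by (rule has_induced_matching_mono) auto
      then have "has_induced_matching (Suc (p - 1)) S"
        using vS[of i] vS[of j] vadj[of i j] that by auto
      then show False using less.prems(1,3) by simp
    qed
    have A_clique: "card Q \<le> m + 2 - j"
      if ij: "1 \<le> i" "i < j" "j \<le> m" and Q: "Q \<subseteq> ?A i j" "clique Q" for i j Q
    proof -
      let ?L = "v ` ({1..<j} - {i})"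
      have "?L \<subseteq> K" using ij vK by auto
      then have LS: "?L \<subseteq> S" "clique ?L" using K(1,2) unfolding clique_def by blast+
      have "clique (Q \<union> ?L)"
        using Q LS(2) adj_sym unfolding clique_def by blast
      then have "card (Q \<union> ?L) \<le> m" using Q(1) LS(1) by (intro max) auto
      moreover have "Q \<inter> ?L = {}" using Q(1) adj_irrefl by blast
      moreover have "finite Q" using Q(1) less.prems(2) by (auto intro: finite_subset)
      moreover have "card ?L = j - 2"
        using ij inj by (subst card_image) (auto intro: inj_on_subset)
      ultimately show ?thesis using ij by (simp add: card_Un_disjoint)
    qed
    have max': "card Q \<le> m" if "Q \<subseteq> S" "finite Q" "clique Q" for Q
      using max that by blast
    note step = colorable_by_max_clique[OF m inj, of S, unfolded vK, OF K(1,2) max']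
    show ?thesis
    proof (cases "p = 2")
      case True
      \<comment> \<open>Now \<open>p - 1 = 1\<close>, so every set of level \<open>j\<close> is
        edgeless and one colour suffices for it. Level 2 gets a second one for \<open>v 1\<close>;
        the total is \<open>2 + (m - 2) + 1\<close>.\<close>
      have "colorable S ((\<Sum>j = 2..m. if j = 2 then 2 else 1) + 1)"
      proof (rule step)
        fix i j assume ij: "1 \<le> i" "i < j" "j \<le> m"
        have "\<not> adj x y" if "x \<in> ?A i j" "y \<in> ?A i j" for x y
          using A_free[OF ij] that True by auto
        then have "colorable (?A i j) 1" by (rule colorable_1_if_no_edge)
        then show "colorable (?A i j) (if j = 2 then 2 else 1)"
          by (rule colorable_mono) auto
      qed auto
      also have "(\<Sum>j = 2..m. if j = 2 then 2 else 1) + 1 = m + (1::nat)"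
        using m by (simp add: sum.atLeast_Suc_atMost)
      finally show ?thesis using True m by (simp add: chi_bound_p2)
    next
      case False
      then have p: "p \<ge> 3" using less.prems(1) by simp
      have "colorable S ((\<Sum>j = 2..m. chi_bound (p - 1) (m + 2 - j)) + 1)"
      proof (rule step)
        show "chi_bound (p - 1) (m + 2 - 2) \<ge> 2"
          using p m by (intro chi_bound_ge_2) auto
        fix j assume "j \<in> {2..m}"
        then have "chi_bound (p - 1) (m + 2 - j) \<ge> 2"
          using p by (intro chi_bound_ge_2) auto
        then show "chi_bound (p - 1) (m + 2 - j) \<ge> 1" by simp
      next
        fix i j assume ij: "1 \<le> i" "i < j" "j \<le> m"
        show "colorable (?A i j) (chi_bound (p - 1) (m + 2 - j))"
          using p less.prems(2) A_free[OF ij] A_clique[OF ij] by (intro less.IH) auto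
      qed
      \<comment> \<open>As \<open>j\<close> runs up from 2 to \<open>m\<close>, the clique bound
        \<open>m + 2 - j\<close> runs down from \<open>m\<close> to 2.\<close>
      also have "(\<Sum>j = 2..m. chi_bound (p - 1) (m + 2 - j)) = (\<Sum>j = 2..m. chi_bound (p - 1) j)"
        by (rule sum.atLeastAtMost_rev[symmetric])
      finally show ?thesis using sum_chi_bound_le[OF p m] colorable_mono by blast
    qed
  qed
  then show ?case
    using colorable_mono chi_bound_mono[OF less.prems(1) \<open>m \<le> n\<close>] by blast
qed

end

section \<open>Transfer to graphs\<close>

text \<open>Forbidden subgraphs are found as embeddings of the pattern into \<open>G\<close>,
  whereas \<open>free_of\<close> speaks of maps from the subgraph to the pattern; the inverse of
  \<open>f\<close> is such a map.\<close>

lemma not_free_ofI: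
  assumes "H \<in> \<F>" "inj_on f (verts H)" "f ` verts H \<subseteq> verts G"
    and "\<And>i j. \<lbrakk>i \<in> verts H; j \<in> verts H\<rbrakk> \<Longrightarrow> {f i, f j} \<in> edges G \<longleftrightarrow> {i, j} \<in> edges H"
  shows "\<not> free_of \<F> G"
proof -
  let ?S = "f ` verts H" and ?g = "the_inv_into (verts H) f"
  have "bij_betw ?g ?S (verts H)"
    using assms(2) by (simp add: bij_betw_the_inv_into inj_on_imp_bij_betw)
  moreover have "{u, v} \<in> edges (induced_subgraph G ?S) \<longleftrightarrow> {?g u, ?g v} \<in> edges H"
    if "u \<in> ?S" "v \<in> ?S" for u v
    using that assms(2,4) by (auto simp: induced_subgraph_def the_inv_into_f_f)
  ultimately have "isomorphic (induced_subgraph G ?S) H"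
    unfolding isomorphic_def by (intro exI[of _ ?g]) (simp add: induced_subgraph_def)
  then show ?thesis using assms(1,3) unfolding free_of_def by blast
qed

lemma matching_graph_edge_iff:
  assumes "i < 2 * p" "j < 2 * p"
  shows "{i, j} \<in> edges (matching_graph p) \<longleftrightarrow> i \<noteq> j \<and> i div 2 = j div 2"
proof
  assume "{i, j} \<in> edges (matching_graph p)"
  then show "i \<noteq> j \<and> i div 2 = j div 2"
    by (auto simp: matching_graph_def doubleton_eq_iff)
next
  assume *: "i \<noteq> j \<and> i div 2 = j div 2"
  have "{i, j} = {2 * (i div 2), 2 * (i div 2) + 1}"
    using * by (auto simp: doubleton_eq_iff)
  moreover have "i div 2 < p" using assms by auto
  ultimately show "{i, j} \<in> edges (matching_graph p)"
    unfolding matching_graph_def by auto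
qed

lemma cycle_graph_4: "cycle_graph 4 = ({0, 1, 2, 3}, {{0, 1}, {1, 2}, {2, 3}, {3, 0}})"
proof -
  have *: "{..<4::nat} = {0, 1, 2, 3}" by auto
  have "{{i, (i + 1) mod 4} |i. i < 4} = (\<lambda>i. {i, (i + 1) mod 4}) ` {..<4::nat}" by blast
  then show ?thesis unfolding cycle_graph_def * by (simp del: One_nat_def)
qed

theorem theorem3p12:
  fixes G :: "'a sgraph" and p :: nat
  assumes "p \<ge> 2"
    and "fin_simple_graph G"
    and "free_of {matching_graph p, cycle_graph 4} G"
  shows "chromatic_number G \<le> chi_bound p (clique_number G)"
proof -
  let ?adj = "\<lambda>u v. {u, v} \<in> edges G"
  have fin: "finite (verts G)" and E: "edges G \<subseteq> [verts G]\<^bsup>2\<^esup>"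
    using assms(2) by (auto simp: fin_simple_graph_def)
  have in_verts: "u \<in> verts G" "v \<in> verts G" "u \<noteq> v" if "?adj u v" for u v
    using that E by (auto simp: nsets_def card_insert_if split: if_splits)
  interpret c4_free_relation ?adj
  proof
    fix a b c d
    assume cyc: "?adj a b" "?adj b c" "?adj c d" "?adj d a" "a \<noteq> c" "b \<noteq> d"
    show "?adj a c \<or> ?adj b d"
    proof (rule ccontr)
      assume neg: "\<not> (?adj a c \<or> ?adj b d)"
      define f where "f = (\<lambda>i::nat. if i = 0 then a else if i = 1 then b else if i = 2 then c else d)"
      have f: "f 0 = a" "f (Suc 0) = b" "f 2 = c" "f 3 = d" by (auto simp: f_def)
      have dist: "a \<noteq> b" "b \<noteq> c" "c \<noteq> d" "d \<noteq> a" using in_verts(3) cyc by blast+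
      \<comment> \<open>The edge condition of \<open>not_free_ofI\<close> also covers
        \<open>i = j\<close>, where \<open>{f i, f j}\<close> is a singleton.\<close>
      have loops: "{x} \<notin> edges G" for x using in_verts(3)[of x x] by auto
      have cyc': "?adj b a" "?adj c b" "?adj d c" "?adj a d" using cyc by (simp_all add: insert_commute)
      have neg': "\<not> ?adj a c" "\<not> ?adj c a" "\<not> ?adj b d" "\<not> ?adj d b"
        using neg by (simp_all add: insert_commute)
      have "\<not> free_of {matching_graph p, cycle_graph 4} G"
      proof (rule not_free_ofI[of "cycle_graph 4" _ f])
        show "inj_on f (verts (cycle_graph 4))"
          using dist cyc(5,6) by (auto simp: cycle_graph_4 f)
        show "f ` verts (cycle_graph 4) \<subseteq> verts G"
          using in_verts cyc by (auto simp: cycle_graph_4 f)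
        show "{f i, f j} \<in> edges G \<longleftrightarrow> {i, j} \<in> edges (cycle_graph 4)"
          if "i \<in> verts (cycle_graph 4)" "j \<in> verts (cycle_graph 4)" for i j
        proof -
          have "i = 0 \<or> i = 1 \<or> i = 2 \<or> i = 3" "j = 0 \<or> j = 1 \<or> j = 2 \<or> j = 3"
            using that by (simp_all add: cycle_graph_4)
          then show ?thesis unfolding cycle_graph_4
            by (elim disjE) (simp_all add: f doubleton_eq_iff cyc(1-4) cyc' neg' loops)
        qed
      qed simp
      then show False using assms(3) by blast
    qed
  qed (simp add: insert_commute, use in_verts(3) in blast)
  have "\<not> has_induced_matching p (verts G)"
  proof
    assume "has_induced_matching p (verts G)"
    then obtain f where f: "inj_on f {..<2 * p}" "f ` {..<2 * p} \<subseteq> verts G"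
      "\<forall>i<2 * p. \<forall>j<2 * p. ?adj (f i) (f j) \<longleftrightarrow> i \<noteq> j \<and> i div 2 = j div 2"
      using has_induced_matching_embedding by blast
    \<comment> \<open>In both numberings the edge with index \<open>k\<close> has the ends
      \<open>2 * k\<close> and \<open>2 * k + 1\<close>, so \<open>f\<close> is already an embedding
      of the pattern.\<close>
    have V: "verts (matching_graph p) = {..<2 * p}" by (simp add: matching_graph_def)
    have "\<not> free_of {matching_graph p, cycle_graph 4} G"
      using f by (intro not_free_ofI[of "matching_graph p" _ f])
        (auto simp: V matching_graph_edge_iff)
    then show False using assms(3) by blast
  qed
  moreover have "card Q \<le> clique_number G" if Q: "Q \<subseteq> verts G" "clique Q" for Q
  proof -
    have "is_clique G Q"
      using Q by (auto simp: is_clique_def clique_def nsets_def card_2_iff)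
    moreover have "finite {card K |K. is_clique G K}"
      by (rule finite_subset[of _ "card ` Pow (verts G)"]) (use fin in \<open>auto simp: is_clique_def\<close>)
    ultimately show ?thesis unfolding clique_number_def by (intro Max_ge) auto
  qed
  ultimately have "colorable (verts G) (chi_bound p (clique_number G))"
    using assms(1) fin by (intro colorable_chi_bound)
  then obtain c where c: "c ` verts G \<subseteq> {..<chi_bound p (clique_number G)}"
    "\<forall>u\<in>verts G. \<forall>v\<in>verts G. ?adj u v \<longrightarrow> c u \<noteq> c v"
    unfolding colorable_def by blast
  then have "proper_coloring G (chi_bound p (clique_number G)) c"
    unfolding proper_coloring_def using in_verts by blast
  then show ?thesis unfolding chromatic_number_def by (intro Least_le) blast
qed

end
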